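(* Let $\{\mathbf{W}_j\}_{j\in T_2}\subset\ell^2(\Lambda,\mathbb{C}^S)$. Define the $S\times(P+1)$ window matrix $\mathbf{M}=[\mathbf{W}_0\ \mathbf{W}_1\ \cdots\ \mathbf{W}_P]$, i.e. for $1\le l\le S$, $1\le l'\le P+1$ its $(l,l')$ entry is the scalar sequence $[\mathbf{M}]_{ll'}=[\mathbf{W}_{l'-1}]_l=\{[\mathbf{W}_{l'-1}(\lambda)]_l\}_{\lambda\in\Lambda}\in\ell^2(\Lambda,\mathbb{C})$. Then the following hold. (i) If $\mathcal{G}(\Lambda,T_1,T_2,\mathbf{W}_j)$ is a DVNUG frame for $\ell^2(\Lambda,\mathbb{C}^S)$ with bounds $A_0$ and $B_0$, then each row of $\mathbf{M}$ generates a discrete nonuniform Gabor frame for $\ell^2(\Lambda,\mathbb{C})$; that is, for each $l_0\in\{1,2,\dots,S\}$ the system $$\{E_{\frac mM}R_{2N\lambda}[\mathbf{M}]_{l_0l'}:\lambda\in\Lambda,\ m\in T_1,\ 1\le l'\le P+1\}$$ is a discrete nonuniform Gabor frame for $\ell^2(\Lambda,\mathbb{C})$. The converse is not true in general: there exist parameters $N,r,M,P,S$ and windows $\{\mathbf{W}_j\}_{j\in T_2}\subset\ell^2(\Lambda,\mathbb{C}^S)$ such that each row of $\mathbf{M}$ generates a discrete nonuniform Gabor frame for $\ell^2(\Lambda,\mathbb{C})$ but $\mathcal{G}(\Lambda,T_1,T_2,\mathbf{W}_j)$ is not a DVNUG frame for $\ell^2(\Lambda,\mathbb{C}^S)$.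 (ii) $\mathcal{G}(\Lambda,T_1,T_2,\mathbf{W}_j)$ is a DVNUG Bessel sequence in $\ell^2(\Lambda,\mathbb{C}^S)$ if and only if each entry of $\mathbf{M}$ generates a discrete nonuniform Gabor Bessel sequence in $\ell^2(\Lambda,\mathbb{C})$; that is, if and only if for each $1\le l\le S$, $1\le l'\le P+1$ the system $$\{E_{\frac mM}R_{2N\lambda}[\mathbf{M}]_{ll'}:\lambda\in\Lambda,\ m\in T_1\}$$ is a discrete nonuniform Gabor Bessel sequence in $\ell^2(\Lambda,\mathbb{C})$.
   Context: Standing setting: $N,M,S\in\mathbb{N}$ (positive integers; the integer $M$ is not to be confused with the window matrix $\mathbf{M}$), $P\in\mathbb{N}\cup\{0\}$, $r$ is an odd integer coprime with $N$ with $1\le r\le 2N-1$, $\Lambda=\{0,\frac{r}{N}\}+2\mathbb{Z}$, $T_1=\{0,1,\dots,M-1\}$, $T_2=\{0,1,\dots,P\}$. For $\mathbf{X}\in\mathbb{C}^S$, $[\mathbf{X}]_k$ is its $k$-th coordinate. $\ell^2(\Lambda,\mathbb{C}^S)$ is the Hilbert space of families $\mathbf{Z}=\{\mathbf{Z}(\lambda)\}_{\lambda\in\Lambda}\subset\mathbb{C}^S$ with $\sum_{\lambda\in\Lambda}\sum_{k=1}^S|[\mathbf{Z}(\lambda)]_k|^2<\infty$, with inner product $\langle\mathbf{Z},\mathbf{W}\rangle=\sum_{\lambda\in\Lambda}\sum_{k=1}^S[\mathbf{Z}(\lambda)]_k\overline{[\mathbf{W}(\lambda)]_k}$ and induced norm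 $\|\cdot\|_{\ell^2}$; $\ell^2(\Lambda,\mathbb{C})$ is the case $S=1$. Operators on $\ell^2(\Lambda,\mathbb{C}^S)$ (for every $S$, including $S=1$): for $\lambda\in\Lambda$, $(R_{2N\lambda}\mathbf{Z})(\lambda')=\mathbf{Z}(\lambda'-2N\lambda)$, $\lambda'\in\Lambda$ (well defined since $2N\Lambda\subset 2\mathbb{Z}$); for $m\in T_1$, $(E_{\frac mM}\mathbf{Z})(\lambda')=e^{2\pi i\frac mM\lambda'}\mathbf{Z}(\lambda')$, $\lambda'\in\Lambda$. $\mathcal{G}(\Lambda,T_1,T_2,\mathbf{W}_j)$ denotes the collection $\{E_{\frac mM}R_{2N\lambda}\mathbf{W}_j:\lambda\in\Lambda,\,m\in T_1,\,j\in T_2\}$ (the discrete vector-valued nonuniform Gabor system, DVNUG system, with window sequences $\mathbf{W}_j$). It is a DVNUG frame for $\ell^2(\Lambda,\mathbb{C}^S)$ with (lower and upper) bounds $\alpha,\beta$ ($0<\alpha\le\beta<\infty$) if $\alpha\|\mathbf{Z}\|_{\ell^2}^2\le\sum_{m\in T_1,\,j\in T_2,\,\lambda\in\Lambda}|\langle\mathbf{Z},E_{\frac mM}R_{2N\lambda}\mathbf{W}_j\rangle|^2\le\beta\|\mathbf{Z}\|_{\ell^2}^2$ for all $\mathbf{Z}\in\ell^2(\Lambda,\mathbb{C}^S)$; it is a DVNUG Bessel sequence if the right-hand inequality holds for some $0<\beta<\infty$ and all $\mathbf{Z}$. "Discrete nonuniform Gabor frame / Bessel sequence" for $\ell^2(\Lambda,\mathbb{C})$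 means the same notions for $S=1$, for the displayed system of scalar sequences (with the sum taken over the indices displayed in that system). *)

theory Defs
  imports "HOL-Analysis.Analysis"
begin

definition Lam :: "nat \<Rightarrow> int \<Rightarrow> real set" where
  "Lam N r = {a + 2 * of_int k | a k. a \<in> {0, of_int r / of_nat N}}"

(* A family (Z(x)), x in Lambda, of vectors in C^S is a function Z with Z x k the k-th
   coordinate of Z(x), 1 <= k <= S.  The dimension S is a natural number, not a type, because
   it is also quantified existentially. *)
type_synonym vseq = "real \<Rightarrow> nat \<Rightarrow> complex"

(* The value 0 off Lambda x {1..S} makes the representation of a family unique; shift_op
   (by elements of 2 N Lambda) and mod_op preserve this convention.
   The space l^2(Lambda, C) is the case S = 1. *)
definition ell2 :: "real set \<Rightarrow> nat \<Rightarrow> vseq set" where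
  "ell2 L S = {Z. (\<forall>x k. \<not> (x \<in> L \<and> k \<in> {1..S}) \<longrightarrow> Z x k = 0) \<and>
                  (\<lambda>x. \<Sum>k=1..S. (cmod (Z x k))\<^sup>2) summable_on L}"

definition ell2_inner :: "real set \<Rightarrow> nat \<Rightarrow> vseq \<Rightarrow> vseq \<Rightarrow> complex" where
  "ell2_inner L S Z W = (\<Sum>\<^sub>\<infinity>x\<in>L. \<Sum>k=1..S. Z x k * cnj (W x k))"

definition ell2_norm :: "real set \<Rightarrow> nat \<Rightarrow> vseq \<Rightarrow> real" where
  "ell2_norm L S Z = sqrt (Re (ell2_inner L S Z Z))"

definition shift_op :: "real \<Rightarrow> vseq \<Rightarrow> vseq" where
  "shift_op a Z = (\<lambda>x. Z (x - a))"

definition mod_op :: "real \<Rightarrow> vseq \<Rightarrow> vseq" where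
  "mod_op t Z = (\<lambda>x k. exp (2 * complex_of_real pi * \<i> * complex_of_real t * complex_of_real x) * Z x k)"

definition gabor_elem :: "nat \<Rightarrow> nat \<Rightarrow> (nat \<Rightarrow> vseq) \<Rightarrow> nat \<times> nat \<times> real \<Rightarrow> vseq" where
  "gabor_elem N M W = (\<lambda>(m, j, x). mod_op (of_nat m / of_nat M) (shift_op (2 * of_nat N * x) (W j)))"

definition gabor_index :: "nat \<Rightarrow> int \<Rightarrow> nat \<Rightarrow> nat set \<Rightarrow> (nat \<times> nat \<times> real) set" where
  "gabor_index N r M J = {0..<M} \<times> J \<times> Lam N r"

definition gabor_coeff ::
  "nat \<Rightarrow> int \<Rightarrow> nat \<Rightarrow> nat \<Rightarrow> (nat \<Rightarrow> vseq) \<Rightarrow> vseq \<Rightarrow> nat \<times> nat \<times> real \<Rightarrow> real" where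
  "gabor_coeff N r M S W Z i = (cmod (ell2_inner (Lam N r) S Z (gabor_elem N M W i)))\<^sup>2"

(* In both definitions J is the finite set indexing the windows.  The upper inequality contains
   the convergence of the series, which has to be demanded separately since a divergent infsum
   is 0. *)
definition dvnug_frame_bounds ::
  "nat \<Rightarrow> int \<Rightarrow> nat \<Rightarrow> nat \<Rightarrow> nat set \<Rightarrow> (nat \<Rightarrow> vseq) \<Rightarrow> real \<Rightarrow> real \<Rightarrow> bool" where
  "dvnug_frame_bounds N r M S J W \<alpha> \<beta> \<longleftrightarrow> 0 < \<alpha> \<and> \<alpha> \<le> \<beta> \<and>
     (\<forall>Z\<in>ell2 (Lam N r) S.
        gabor_coeff N r M S W Z summable_on gabor_index N r M J \<and>
        \<alpha> * (ell2_norm (Lam N r) S Z)\<^sup>2 \<le> infsum (gabor_coeff N r M S W Z) (gabor_index N r M J) \<and>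
        infsum (gabor_coeff N r M S W Z) (gabor_index N r M J) \<le> \<beta> * (ell2_norm (Lam N r) S Z)\<^sup>2)"

definition dvnug_frame :: "nat \<Rightarrow> int \<Rightarrow> nat \<Rightarrow> nat \<Rightarrow> nat set \<Rightarrow> (nat \<Rightarrow> vseq) \<Rightarrow> bool" where
  "dvnug_frame N r M S J W \<longleftrightarrow> (\<exists>\<alpha> \<beta>. dvnug_frame_bounds N r M S J W \<alpha> \<beta>)"

definition dvnug_bessel :: "nat \<Rightarrow> int \<Rightarrow> nat \<Rightarrow> nat \<Rightarrow> nat set \<Rightarrow> (nat \<Rightarrow> vseq) \<Rightarrow> bool" where
  "dvnug_bessel N r M S J W \<longleftrightarrow> (\<exists>\<beta>>0. \<forall>Z\<in>ell2 (Lam N r) S.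
     gabor_coeff N r M S W Z summable_on gabor_index N r M J \<and>
     infsum (gabor_coeff N r M S W Z) (gabor_index N r M J) \<le> \<beta> * (ell2_norm (Lam N r) S Z)\<^sup>2)"

(* The entries are scalar sequences, i.e. families with the single coordinate k = 1.
   Rows are numbered 1..S and columns 1..P+1, whereas windows are numbered 0..P. *)
definition window_matrix :: "(nat \<Rightarrow> vseq) \<Rightarrow> nat \<Rightarrow> nat \<Rightarrow> vseq" where
  "window_matrix W l l' = (\<lambda>x k. if k = 1 then W (l' - 1) x l else 0)"

end

theory Submission
  imports Defs
begin

text \<open>
  A family supported on the single coordinate \<open>l\<close> sees only the \<open>l\<close>-th components of the windows, so
  its Gabor coefficients are those of a scalar sequence for row \<open>l\<close> of the window matrix, with
  equal norms; this transfers frame and Bessel bounds to rows. Conversely, every coefficient is the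
  sum over \<open>l\<close> of the scalar coefficients of the coordinates, and Cauchy--Schwarz adds up the
  scalar Bessel bounds. For the failing converse take \<open>\<Lambda> = \<int>\<close>, \<open>M = 1\<close> and
  two windows whose two rows both consist of \<open>\<delta>\<^sub>0, \<delta>\<^sub>1\<close>: each row generates the standard orthonormal
  basis, but since the rows agree, \<open>(\<delta>\<^sub>0, -\<delta>\<^sub>0)\<close> is orthogonal to the whole system.
\<close>

declare One_nat_def [simp del]

section \<open>Passing between vector-valued and scalar families\<close>

definition coord :: "nat \<Rightarrow> vseq \<Rightarrow> vseq" where
  "coord l Z = (\<lambda>x k. if k = 1 then Z x l else 0)"

text \<open>For \<open>l\<close> in \<open>{1..S}\<close> this is an isometry into
  \<open>ell2 L S\<close> with adjoint \<open>coord l\<close>; these two facts carry the passage to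
  rows.\<close>

definition coord_embed :: "nat \<Rightarrow> vseq \<Rightarrow> vseq" where
  "coord_embed l z = (\<lambda>x k. if k = l then z x 1 else 0)"

text \<open>Modulation and translation act on each coordinate separately, so they commute with
  taking a coordinate. \<open>Suc j\<close> appears because window \<open>j\<close> is column
  \<open>j + 1\<close> of the matrix.\<close>

lemma gabor_elem_window_matrix:
  "gabor_elem N M (window_matrix W l) (m, Suc j, x) = coord l (gabor_elem N M W (m, j, x))"
  by (auto simp: gabor_elem_def window_matrix_def coord_def mod_op_def shift_op_def fun_eq_iff)

section \<open>Interchange of finite sums and series\<close>

lemma has_sum_finite_sum:
  fixes f :: "'i \<Rightarrow> 'a \<Rightarrow> 'b::topological_comm_monoid_add"
  assumes "finite I" "\<And>i. i \<in> I \<Longrightarrow> (f i has_sum s i) A"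
  shows "((\<lambda>x. \<Sum>i\<in>I. f i x) has_sum (\<Sum>i\<in>I. s i)) A"
  using assms by (induction I rule: finite_induct) (auto intro: has_sum_add)

lemma summable_on_sum:
  fixes f :: "'i \<Rightarrow> 'a \<Rightarrow> 'b::{topological_comm_monoid_add, t2_space}"
  assumes "finite I" "\<And>i. i \<in> I \<Longrightarrow> f i summable_on A"
  shows "(\<lambda>x. \<Sum>i\<in>I. f i x) summable_on A"
proof -
  have "((\<lambda>x. \<Sum>i\<in>I. f i x) has_sum (\<Sum>i\<in>I. infsum (f i) A)) A"
    by (intro has_sum_finite_sum has_sum_infsum assms)
  then show ?thesis by (auto simp: summable_on_def)
qed

lemma infsum_sum:
  fixes f :: "'i \<Rightarrow> 'a \<Rightarrow> 'b::{topological_comm_monoid_add, t2_space}"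
  assumes "finite I" "\<And>i. i \<in> I \<Longrightarrow> f i summable_on A"
  shows "(\<Sum>\<^sub>\<infinity>x\<in>A. \<Sum>i\<in>I. f i x) = (\<Sum>i\<in>I. infsum (f i) A)"
  by (intro infsumI has_sum_finite_sum has_sum_infsum assms)

subsection \<open>The space of square-summable families\<close>

lemma ell2_norm_squared: "(ell2_norm L S Z)\<^sup>2 = (\<Sum>\<^sub>\<infinity>x\<in>L. \<Sum>k=1..S. (cmod (Z x k))\<^sup>2)"
proof -
  let ?f = "\<lambda>x. \<Sum>k=1..S. (cmod (Z x k))\<^sup>2"
  have *: "(\<Sum>k=1..S. Z x k * cnj (Z x k)) = complex_of_real (?f x)" for x
    by (simp only: complex_norm_square of_real_sum)
  have "Re (\<Sum>\<^sub>\<infinity>x\<in>L. complex_of_real (?f x)) = infsum ?f L"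
  proof (cases "?f summable_on L")
    case True
    then have "Re (\<Sum>\<^sub>\<infinity>x\<in>L. complex_of_real (?f x)) = (\<Sum>\<^sub>\<infinity>x\<in>L. Re (complex_of_real (?f x)))"
      by (intro infsum_Re[symmetric] summable_on_of_real)
    then show ?thesis by simp
  next
    \<comment> \<open>For a divergent series both sides carry the default value 0 of
      \<open>infsum\<close>, so the equality persists.\<close>
    case False
    have "\<not> (\<lambda>x. complex_of_real (?f x)) summable_on L"
    proof
      assume "(\<lambda>x. complex_of_real (?f x)) summable_on L"
      from summable_on_Re[OF this] have "?f summable_on L" by simp
      with False show False ..
    qed
    then have "(\<Sum>\<^sub>\<infinity>x\<in>L. complex_of_real (?f x)) = 0"
      by (rule infsum_not_exists)
    moreover from False have "infsum ?f L = 0"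
      by (rule infsum_not_exists)
    ultimately show ?thesis by simp
  qed
  \<comment> \<open>Nonnegativity lets the square cancel the \<open>sqrt\<close> in
    \<open>ell2_norm\<close>.\<close>
  moreover have "infsum ?f L \<ge> 0"
    by (intro infsum_nonneg sum_nonneg) auto
  ultimately show ?thesis
    unfolding ell2_norm_def ell2_inner_def * by simp
qed

lemma ell2_component_summable:
  assumes "Z \<in> ell2 L S" "k \<in> {1..S}"
  shows "(\<lambda>x. (cmod (Z x k))\<^sup>2) summable_on L"
proof (rule summable_on_comparison_test)
  show "(\<lambda>x. \<Sum>k=1..S. (cmod (Z x k))\<^sup>2) summable_on L"
    using assms(1) by (simp add: ell2_def)
  show "(cmod (Z x k))\<^sup>2 \<le> (\<Sum>k=1..S. (cmod (Z x k))\<^sup>2)" for x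
    by (rule member_le_sum[OF assms(2)]) auto
qed auto

lemma coord_in_ell2:
  assumes "Z \<in> ell2 L S" "l \<in> {1..S}"
  shows "coord l Z \<in> ell2 L 1"
  using ell2_component_summable[OF assms] assms by (auto simp: ell2_def coord_def)

lemma embed_norm_squared_sum:
  assumes "l \<in> {1..S}"
  shows "(\<Sum>k=1..S. (cmod (coord_embed l z x k))\<^sup>2) = (cmod (z x 1))\<^sup>2"
proof -
  have "(\<Sum>k=1..S. (cmod (coord_embed l z x k))\<^sup>2) = (\<Sum>k=1..S. if k = l then (cmod (z x 1))\<^sup>2 else 0)"
    by (intro sum.cong) (auto simp: coord_embed_def)
  then show ?thesis using assms by simp
qed

lemma embed_in_ell2:
  assumes "z \<in> ell2 L 1" "l \<in> {1..S}"
  shows "coord_embed l z \<in> ell2 L S"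
proof -
  have "(\<lambda>x. \<Sum>k=1..S. (cmod (coord_embed l z x k))\<^sup>2) summable_on L"
    using ell2_component_summable[OF assms(1), of 1] by (simp add: embed_norm_squared_sum[OF assms(2)])
  moreover have "coord_embed l z x k = 0" if "\<not> (x \<in> L \<and> k \<in> {1..S})" for x k
    using that assms by (auto simp: ell2_def coord_embed_def)
  ultimately show ?thesis
    by (simp add: ell2_def)
qed

lemma ell2_norm_embed:
  assumes "l \<in> {1..S}"
  shows "(ell2_norm L S (coord_embed l z))\<^sup>2 = (ell2_norm L 1 z)\<^sup>2"
  unfolding ell2_norm_squared embed_norm_squared_sum[OF assms] by simp

text \<open>Pythagoras over the coordinates: the finite sum over \<open>l\<close> is exchanged with
  the series over \<open>L\<close>.\<close>

lemma ell2_norm_coord: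
  assumes "Z \<in> ell2 L S"
  shows "(\<Sum>l=1..S. (ell2_norm L 1 (coord l Z))\<^sup>2) = (ell2_norm L S Z)\<^sup>2"
  unfolding ell2_norm_squared
  using infsum_sum[of "{1..S}" "\<lambda>k x. (cmod (Z x k))\<^sup>2" L] ell2_component_summable[OF assms]
  by (simp add: coord_def)

text \<open>Adjointness: only the summand \<open>k = l\<close> survives in the inner
  product.\<close>

lemma ell2_inner_embed:
  assumes "l \<in> {1..S}"
  shows "ell2_inner L S (coord_embed l z) Y = ell2_inner L 1 z (coord l Y)"
proof -
  have "(\<Sum>k=1..S. coord_embed l z x k * cnj (Y x k)) = z x 1 * cnj (Y x l)" for x
  proof -
    have "(\<Sum>k=1..S. coord_embed l z x k * cnj (Y x k))
        = (\<Sum>k=1..S. if k = l then z x 1 * cnj (Y x l) else 0)"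
      by (intro sum.cong) (auto simp: coord_embed_def)
    then show ?thesis using assms by simp
  qed
  then show ?thesis
    by (simp add: ell2_inner_def coord_def)
qed

text \<open>Square-summability of both families makes each coordinate's product series converge
  absolutely, so the sum over coordinates can be pulled out of the series.\<close>

lemma ell2_inner_decompose:
  assumes "Z \<in> ell2 L S" "Y \<in> ell2 L S"
  shows "ell2_inner L S Z Y = (\<Sum>l=1..S. ell2_inner L 1 (coord l Z) (coord l Y))"
proof -
  have "(\<lambda>x. Z x k * cnj (Y x k)) summable_on L" if k: "k \<in> {1..S}" for k
  proof (rule abs_summable_summable, rule summable_on_comparison_test)
    show "(\<lambda>x. (cmod (Z x k))\<^sup>2 + (cmod (Y x k))\<^sup>2) summable_on L"
      using ell2_component_summable[OF assms(1) k] ell2_component_summable[OF assms(2) k]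
      by (rule summable_on_add)
    show "norm (Z x k * cnj (Y x k)) \<le> (cmod (Z x k))\<^sup>2 + (cmod (Y x k))\<^sup>2" for x
    proof -
      \<comment> \<open>Arithmetic-geometric mean inequality; the factor 2 may be dropped because
        the product is nonnegative.\<close>
      have "2 * (cmod (Z x k) * cmod (Y x k)) \<le> (cmod (Z x k))\<^sup>2 + (cmod (Y x k))\<^sup>2"
        using sum_squares_bound[of "cmod (Z x k)" "cmod (Y x k)"] by (simp add: mult.assoc)
      moreover have "0 \<le> cmod (Z x k) * cmod (Y x k)" by simp
      ultimately show ?thesis by (simp only: norm_mult complex_mod_cnj)
    qed
  qed simp
  then show ?thesis
    using infsum_sum[of "{1..S}" "\<lambda>k x. Z x k * cnj (Y x k)" L]
    by (simp add: ell2_inner_def coord_def)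
qed

section \<open>Invariance of \<open>Lam N r\<close> and of \<open>ell2\<close> under the Gabor
  operators\<close>

lemma Lam_add_even_iff: "x + 2 * of_int n \<in> Lam N r \<longleftrightarrow> x \<in> Lam N r"
proof -
  have *: "x + 2 * of_int n \<in> Lam N r" if "x \<in> Lam N r" for x n
  proof -
    from that obtain a k where "a \<in> {0, of_int r / of_nat N}" "x = a + 2 * of_int k"
      unfolding Lam_def by blast
    then have "x + 2 * of_int n = a + 2 * of_int (k + n)" by simp
    with \<open>a \<in> _\<close> show ?thesis unfolding Lam_def by blast
  qed
  show ?thesis
    using *[of x n] *[of "x + 2 * of_int n" "- n"] by auto
qed

lemma Lam_diff_even_iff: "x - 2 * of_int n \<in> Lam N r \<longleftrightarrow> x \<in> Lam N r"
  using Lam_add_even_iff[of x "- n" N r] by simp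

text \<open>Multiplication by \<open>N\<close> clears the denominator of \<open>r / N\<close>. Hence
  the shifts \<open>2 * N * x\<close> of the Gabor system are even integers, which map
  \<open>Lam N r\<close> onto itself.\<close>

lemma N_times_Lam_Ints:
  assumes "x \<in> Lam N r" "N > 0"
  obtains n :: int where "of_nat N * x = of_int n"
proof -
  from assms(1) obtain a k where a: "a \<in> {0, of_int r / of_nat N}" and x: "x = a + 2 * of_int k"
    unfolding Lam_def by blast
  from a show thesis
  proof (elim insertE emptyE)
    assume "a = 0"
    then have "of_nat N * x = of_int (2 * int N * k)" using x by simp
    then show thesis by (rule that)
  next
    assume "a = of_int r / of_nat N"
    then have "of_nat N * x = of_int (r + 2 * int N * k)"
      using x assms(2) by (simp add: field_simps)
    then show thesis by (rule that)
  qed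
qed

text \<open>An even shift permutes \<open>Lam N r\<close>, so the norm series is merely reindexed
  and the zero values off the index set stay there.\<close>

lemma shift_op_in_ell2:
  assumes "Z \<in> ell2 (Lam N r) S"
  shows "shift_op (2 * of_int n) Z \<in> ell2 (Lam N r) S"
proof -
  let ?f = "\<lambda>x. \<Sum>k=1..S. (cmod (Z x k))\<^sup>2"
  have "bij_betw (\<lambda>x. x - 2 * of_int n) (Lam N r) (Lam N r)"
    by (rule bij_betw_byWitness[where f' = "\<lambda>x. x + 2 * of_int n"])
       (auto simp: Lam_diff_even_iff Lam_add_even_iff)
  from summable_on_reindex_bij_betw[OF this, of ?f]
  have "(\<lambda>x. ?f (x - 2 * of_int n)) summable_on Lam N r"
    using assms by (simp add: ell2_def)
  then show ?thesis
    using assms by (auto simp: ell2_def shift_op_def Lam_diff_even_iff)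
qed

lemma mod_op_in_ell2:
  assumes "Z \<in> ell2 L S"
  shows "mod_op t Z \<in> ell2 L S"
proof -
  have "cmod (mod_op t Z x k) = cmod (Z x k)" for x k
    by (simp add: mod_op_def norm_mult)
  then show ?thesis
    using assms by (auto simp: ell2_def mod_op_def)
qed

lemma gabor_elem_in_ell2:
  assumes "W j \<in> ell2 (Lam N r) S" "x \<in> Lam N r" "N > 0"
  shows "gabor_elem N M W (m, j, x) \<in> ell2 (Lam N r) S"
proof -
  from N_times_Lam_Ints[OF assms(2,3)] obtain n :: int where "of_nat N * x = of_int n" .
  then have *: "2 * of_nat N * x = 2 * of_int n" by simp
  show ?thesis
    unfolding gabor_elem_def split * by (intro mod_op_in_ell2 shift_op_in_ell2 assms)
qed

subsection \<open>Rows and entries of the window matrix\<close>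

lemma gabor_coeff_nonneg: "0 \<le> gabor_coeff N r M S W Z i"
  by (simp add: gabor_coeff_def)

text \<open>Adjointness moves the embedding onto the Gabor element, whose \<open>l\<close>-th
  coordinate is the Gabor element of row \<open>l\<close>.\<close>

lemma gabor_coeff_embed:
  assumes "l \<in> {1..S}"
  shows "gabor_coeff N r M S W (coord_embed l z) (m, j, x)
       = gabor_coeff N r M 1 (window_matrix W l) z (m, Suc j, x)"
  by (simp add: gabor_coeff_def gabor_elem_window_matrix ell2_inner_embed[OF assms])

text \<open>Reconciles the window numbering \<open>0..P\<close> with the column numbering
  \<open>1..P+1\<close>, so that series over the two index sets can be exchanged.\<close>

lemma bij_betw_gabor_index_Suc:
  "bij_betw (\<lambda>(m, j, x). (m, Suc j, x)) (gabor_index N r M {0..P}) (gabor_index N r M {1..P+1})"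
  by (rule bij_betw_byWitness[where f' = "\<lambda>(m, j, x). (m, j - 1, x)"])
     (auto simp: gabor_index_def)

lemma gabor_coeff_embed_summable_iff:
  assumes "l \<in> {1..S}"
  shows "gabor_coeff N r M S W (coord_embed l z) summable_on gabor_index N r M {0..P} \<longleftrightarrow>
         gabor_coeff N r M 1 (window_matrix W l) z summable_on gabor_index N r M {1..P+1}"
  unfolding summable_on_reindex_bij_betw[OF bij_betw_gabor_index_Suc, symmetric]
  by (intro summable_on_cong) (auto simp: gabor_coeff_embed[OF assms])

lemma infsum_gabor_coeff_embed:
  assumes "l \<in> {1..S}"
  shows "infsum (gabor_coeff N r M S W (coord_embed l z)) (gabor_index N r M {0..P}) =
         infsum (gabor_coeff N r M 1 (window_matrix W l) z) (gabor_index N r M {1..P+1})"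
  unfolding infsum_reindex_bij_betw[OF bij_betw_gabor_index_Suc, symmetric]
  by (intro infsum_cong) (auto simp: gabor_coeff_embed[OF assms])

text \<open>The vector inequalities are tested on embedded scalar sequences. Norms and coefficient
  sums agree there, so the row inherits the same bounds.\<close>

lemma frame_bounds_row:
  assumes "dvnug_frame_bounds N r M S {0..P} W A B" "l \<in> {1..S}"
  shows "dvnug_frame_bounds N r M 1 {1..P+1} (window_matrix W l) A B"
  unfolding dvnug_frame_bounds_def
proof (intro conjI ballI)
  show "0 < A" "A \<le> B"
    using assms(1) by (auto simp: dvnug_frame_bounds_def)
  fix z assume "z \<in> ell2 (Lam N r) 1"
  then have "coord_embed l z \<in> ell2 (Lam N r) S"
    using assms(2) by (rule embed_in_ell2)
  with assms(1) show
    "gabor_coeff N r M 1 (window_matrix W l) z summable_on gabor_index N r M {1..P+1}"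
    "A * (ell2_norm (Lam N r) 1 z)\<^sup>2
       \<le> infsum (gabor_coeff N r M 1 (window_matrix W l) z) (gabor_index N r M {1..P+1})"
    "infsum (gabor_coeff N r M 1 (window_matrix W l) z) (gabor_index N r M {1..P+1})
       \<le> B * (ell2_norm (Lam N r) 1 z)\<^sup>2"
    unfolding dvnug_frame_bounds_def gabor_coeff_embed_summable_iff[OF assms(2), symmetric]
      infsum_gabor_coeff_embed[OF assms(2), symmetric] ell2_norm_embed[OF assms(2), symmetric, of "Lam N r" z]
    by blast+
qed

lemma bessel_row:
  assumes "dvnug_bessel N r M S {0..P} W" "l \<in> {1..S}"
  shows "dvnug_bessel N r M 1 {1..P+1} (window_matrix W l)"
proof -
  from assms(1) obtain B where "B > 0" and B: "\<And>Z. Z \<in> ell2 (Lam N r) S \<Longrightarrow>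
      gabor_coeff N r M S W Z summable_on gabor_index N r M {0..P} \<and>
      infsum (gabor_coeff N r M S W Z) (gabor_index N r M {0..P}) \<le> B * (ell2_norm (Lam N r) S Z)\<^sup>2"
    unfolding dvnug_bessel_def by blast
  show ?thesis
    unfolding dvnug_bessel_def
  proof (intro exI conjI ballI)
    fix z assume "z \<in> ell2 (Lam N r) 1"
    then have "coord_embed l z \<in> ell2 (Lam N r) S"
      using assms(2) by (rule embed_in_ell2)
    from B[OF this] show
      "gabor_coeff N r M 1 (window_matrix W l) z summable_on gabor_index N r M {1..P+1}"
      "infsum (gabor_coeff N r M 1 (window_matrix W l) z) (gabor_index N r M {1..P+1})
         \<le> B * (ell2_norm (Lam N r) 1 z)\<^sup>2"
      unfolding gabor_coeff_embed_summable_iff[OF assms(2)]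
        infsum_gabor_coeff_embed[OF assms(2)] ell2_norm_embed[OF assms(2)]
      by blast+
  qed (fact \<open>B > 0\<close>)
qed

section \<open>Bessel bounds for subsets and unions of window sets\<close>

text \<open>Dropping windows only removes nonnegative terms, so the same bound works.\<close>

lemma bessel_subset:
  assumes "dvnug_bessel N r M S J W" "I \<subseteq> J"
  shows "dvnug_bessel N r M S I W"
proof -
  from assms(1) obtain B where "B > 0" and B: "\<And>Z. Z \<in> ell2 (Lam N r) S \<Longrightarrow>
      gabor_coeff N r M S W Z summable_on gabor_index N r M J \<and>
      infsum (gabor_coeff N r M S W Z) (gabor_index N r M J) \<le> B * (ell2_norm (Lam N r) S Z)\<^sup>2"
    unfolding dvnug_bessel_def by blast
  have sub: "gabor_index N r M I \<subseteq> gabor_index N r M J"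
    using assms(2) by (auto simp: gabor_index_def)
  show ?thesis
    unfolding dvnug_bessel_def
  proof (intro exI conjI ballI)
    fix Z assume "Z \<in> ell2 (Lam N r) S"
    note Z = B[OF this]
    show *: "gabor_coeff N r M S W Z summable_on gabor_index N r M I"
      using Z sub summable_on_subset_banach by blast
    have "infsum (gabor_coeff N r M S W Z) (gabor_index N r M I)
        \<le> infsum (gabor_coeff N r M S W Z) (gabor_index N r M J)"
      using * Z sub gabor_coeff_nonneg by (intro infsum_mono2) auto
    with Z show "infsum (gabor_coeff N r M S W Z) (gabor_index N r M I) \<le> B * (ell2_norm (Lam N r) S Z)\<^sup>2"
      by linarith
  qed (fact \<open>B > 0\<close>)
qed

text \<open>Disjoint window sets give disjoint index sets, so the series split and the bounds
  add.\<close>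

lemma bessel_Un_disjoint:
  assumes "dvnug_bessel N r M S I W" "dvnug_bessel N r M S J W" "I \<inter> J = {}"
  shows "dvnug_bessel N r M S (I \<union> J) W"
proof -
  let ?c = "gabor_coeff N r M S W" and ?I = "gabor_index N r M"
  from assms(1) obtain A where "A > 0" and A: "\<And>Z. Z \<in> ell2 (Lam N r) S \<Longrightarrow>
      ?c Z summable_on ?I I \<and> infsum (?c Z) (?I I) \<le> A * (ell2_norm (Lam N r) S Z)\<^sup>2"
    unfolding dvnug_bessel_def by blast
  from assms(2) obtain B where "B > 0" and B: "\<And>Z. Z \<in> ell2 (Lam N r) S \<Longrightarrow>
      ?c Z summable_on ?I J \<and> infsum (?c Z) (?I J) \<le> B * (ell2_norm (Lam N r) S Z)\<^sup>2"
    unfolding dvnug_bessel_def by blast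
  have un: "?I (I \<union> J) = ?I I \<union> ?I J" and disj: "?I I \<inter> ?I J = {}"
    using assms(3) by (auto simp: gabor_index_def)
  show ?thesis
    unfolding dvnug_bessel_def
  proof (intro exI conjI ballI)
    show "A + B > 0" using \<open>A > 0\<close> \<open>B > 0\<close> by simp
    fix Z assume Z: "Z \<in> ell2 (Lam N r) S"
    show "?c Z summable_on ?I (I \<union> J)"
      unfolding un using A[OF Z] B[OF Z] disj by (intro summable_on_Un_disjoint) auto
    have "infsum (?c Z) (?I (I \<union> J)) = infsum (?c Z) (?I I) + infsum (?c Z) (?I J)"
      unfolding un using A[OF Z] B[OF Z] disj by (intro infsum_Un_disjoint) auto
    then show "infsum (?c Z) (?I (I \<union> J)) \<le> (A + B) * (ell2_norm (Lam N r) S Z)\<^sup>2"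
      using A[OF Z] B[OF Z] by (simp add: distrib_right)
  qed
qed

lemma bessel_finite:
  assumes "finite J" "\<And>j. j \<in> J \<Longrightarrow> dvnug_bessel N r M S {j} W"
  shows "dvnug_bessel N r M S J W"
  using assms
proof (induction J rule: finite_induct)
  case empty
  \<comment> \<open>The empty system has coefficient sum 0; the definition asks for a positive
    bound, and 1 serves.\<close>
  show ?case
    unfolding dvnug_bessel_def gabor_index_def by (intro exI[of _ 1]) auto
next
  case (insert j J)
  then show ?case
    using bessel_Un_disjoint[of N r M S "{j}" W J] by auto
qed

section \<open>From entries and rows back to the vector-valued system\<close>

text \<open>The coefficient's inner product is a sum of \<open>S\<close> scalar ones; the triangle
  inequality and Cauchy-Schwarz then cost a factor \<open>S\<close>.\<close>

lemma gabor_coeff_le_sum_coord: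
  assumes "Z \<in> ell2 (Lam N r) S" "W j \<in> ell2 (Lam N r) S" "x \<in> Lam N r" "N > 0"
  shows "gabor_coeff N r M S W Z (m, j, x)
       \<le> of_nat S * (\<Sum>l=1..S. gabor_coeff N r M 1 (window_matrix W l) (coord l Z) (m, Suc j, x))"
proof -
  let ?a = "\<lambda>l. ell2_inner (Lam N r) 1 (coord l Z) (coord l (gabor_elem N M W (m, j, x)))"
  have "gabor_coeff N r M S W Z (m, j, x) = (cmod (\<Sum>l=1..S. ?a l))\<^sup>2"
    unfolding gabor_coeff_def
    by (subst ell2_inner_decompose[OF assms(1) gabor_elem_in_ell2[where r = r]]) (use assms in auto)
  also have "\<dots> \<le> (\<Sum>l=1..S. cmod (?a l))\<^sup>2"
    by (intro power_mono norm_sum) auto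
  \<comment> \<open>Cauchy-Schwarz against the constant vector 1 of length \<open>S\<close>.\<close>
  also have "\<dots> \<le> of_nat S * (\<Sum>l=1..S. (cmod (?a l))\<^sup>2)"
    using sum_squared_le_sum_of_squares[of "\<lambda>l. cmod (?a l)" "{1..S}"] by (simp add: mult.commute)
  finally show ?thesis
    by (simp add: gabor_coeff_def gabor_elem_window_matrix)
qed

text \<open>Summing the coefficientwise estimate over the whole index set bounds the vector series
  by \<open>S\<close> times the row series of the coordinates of \<open>Z\<close>.\<close>

lemma bessel_of_rows:
  assumes "N > 0" "S > 0" "\<forall>j\<in>{0..P}. W j \<in> ell2 (Lam N r) S"
    and rows: "\<And>l. l \<in> {1..S} \<Longrightarrow> dvnug_bessel N r M 1 {1..P+1} (window_matrix W l)"
  shows "dvnug_bessel N r M S {0..P} W"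
proof -
  let ?c = "\<lambda>l. gabor_coeff N r M 1 (window_matrix W l)"
  let ?s = "\<lambda>(m, j, x). (m, Suc j, x) :: nat \<times> nat \<times> real"
  let ?I = "gabor_index N r M {0..P}" and ?I' = "gabor_index N r M {1..P+1}"
  have "\<forall>l\<in>{1..S}. \<exists>b>0. \<forall>z\<in>ell2 (Lam N r) 1.
      ?c l z summable_on ?I' \<and> infsum (?c l z) ?I' \<le> b * (ell2_norm (Lam N r) 1 z)\<^sup>2"
    using rows unfolding dvnug_bessel_def by blast
  then obtain b where pos: "\<And>l. l \<in> {1..S} \<Longrightarrow> b l > 0"
    and b: "\<And>l z. l \<in> {1..S} \<Longrightarrow> z \<in> ell2 (Lam N r) 1 \<Longrightarrow>
      ?c l z summable_on ?I' \<and> infsum (?c l z) ?I' \<le> b l * (ell2_norm (Lam N r) 1 z)\<^sup>2"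
    unfolding bchoice_iff by blast
  \<comment> \<open>A common bound for all rows: it dominates each \<open>b l\<close> because all of
    them are positive.\<close>
  define B where "B = (\<Sum>l=1..S. b l)"
  have "B > 0"
    unfolding B_def using assms(2) pos by (intro sum_pos) auto
  show ?thesis
    unfolding dvnug_bessel_def
  proof (intro exI conjI ballI)
    show "of_nat S * B > 0" using \<open>B > 0\<close> assms(2) by simp
    fix Z assume Z: "Z \<in> ell2 (Lam N r) S"
    let ?g = "\<lambda>i. of_nat S * (\<Sum>l=1..S. ?c l (coord l Z) (?s i))"
    have summ: "(\<lambda>i. ?c l (coord l Z) (?s i)) summable_on ?I"
      and bound: "(\<Sum>\<^sub>\<infinity>i\<in>?I. ?c l (coord l Z) (?s i)) \<le> b l * (ell2_norm (Lam N r) 1 (coord l Z))\<^sup>2"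
      if l: "l \<in> {1..S}" for l
      using b[OF l coord_in_ell2[OF Z l]]
      unfolding summable_on_reindex_bij_betw[OF bij_betw_gabor_index_Suc, of "?c l (coord l Z)"]
        infsum_reindex_bij_betw[OF bij_betw_gabor_index_Suc, of "?c l (coord l Z)"]
      by blast+
    have g: "?g summable_on ?I"
      by (intro summable_on_cmult_right summable_on_sum summ) auto
    have le: "gabor_coeff N r M S W Z i \<le> ?g i" if "i \<in> ?I" for i
      using that assms(1,3) gabor_coeff_le_sum_coord[OF Z]
      by (auto simp: gabor_index_def)
    show c: "gabor_coeff N r M S W Z summable_on ?I"
      using g le gabor_coeff_nonneg by (rule summable_on_comparison_test)
    have "infsum (gabor_coeff N r M S W Z) ?I \<le> infsum ?g ?I"
      using c g le by (rule infsum_mono)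
    also have "\<dots> = of_nat S * (\<Sum>\<^sub>\<infinity>i\<in>?I. \<Sum>l=1..S. ?c l (coord l Z) (?s i))"
      by (rule infsum_cmult_right')
    also have "\<dots> = of_nat S * (\<Sum>l=1..S. \<Sum>\<^sub>\<infinity>i\<in>?I. ?c l (coord l Z) (?s i))"
      by (intro arg_cong[of _ _ "(*) (of_nat S)"] infsum_sum summ) auto
    also have "\<dots> \<le> of_nat S * (\<Sum>l=1..S. B * (ell2_norm (Lam N r) 1 (coord l Z))\<^sup>2)"
    proof (intro mult_left_mono sum_mono)
      fix l assume l: "l \<in> {1..S}"
      have "b l \<le> B"
        unfolding B_def using l pos by (intro member_le_sum) (auto intro: less_imp_le)
      then have "b l * (ell2_norm (Lam N r) 1 (coord l Z))\<^sup>2 \<le> B * (ell2_norm (Lam N r) 1 (coord l Z))\<^sup>2"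
        by (rule mult_right_mono) simp
      with bound[OF l] show "(\<Sum>\<^sub>\<infinity>i\<in>?I. ?c l (coord l Z) (?s i)) \<le> B * (ell2_norm (Lam N r) 1 (coord l Z))\<^sup>2"
        by linarith
    qed simp
    \<comment> \<open>The squared norms of the coordinates add up to that of \<open>Z\<close>,
      giving the Bessel bound \<open>S * B\<close>.\<close>
    also have "\<dots> = of_nat S * B * (ell2_norm (Lam N r) S Z)\<^sup>2"
      by (simp only: sum_distrib_left[symmetric] ell2_norm_coord[OF Z] mult.assoc)
    finally show "infsum (gabor_coeff N r M S W Z) ?I \<le> of_nat S * B * (ell2_norm (Lam N r) S Z)\<^sup>2" .
  qed
qed

text \<open>Rows are the intermediate stage: a row restricts to each of its columns, and its
  finitely many columns together give the row.\<close>

lemma bessel_iff_entries: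
  assumes "N > 0" "S > 0" "\<forall>j\<in>{0..P}. W j \<in> ell2 (Lam N r) S"
  shows "dvnug_bessel N r M S {0..P} W \<longleftrightarrow>
    (\<forall>l\<in>{1..S}. \<forall>l'\<in>{1..P+1}. dvnug_bessel N r M 1 {l'} (window_matrix W l))"
proof (intro iffI ballI)
  fix l l' assume "dvnug_bessel N r M S {0..P} W" "l \<in> {1..S}" "l' \<in> {1..P+1}"
  then show "dvnug_bessel N r M 1 {l'} (window_matrix W l)"
    using bessel_subset[OF bessel_row] by blast
next
  assume *: "\<forall>l\<in>{1..S}. \<forall>l'\<in>{1..P+1}. dvnug_bessel N r M 1 {l'} (window_matrix W l)"
  have "dvnug_bessel N r M 1 {1..P+1} (window_matrix W l)" if "l \<in> {1..S}" for l
    by (rule bessel_finite) (use * that in auto)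
  with assms show "dvnug_bessel N r M S {0..P} W"
    by (rule bessel_of_rows)
qed

subsection \<open>A system of windows with equal rows\<close>

text \<open>The value does not depend on \<open>k\<close> within \<open>{1..2}\<close>, which makes
  the two rows of the window matrix equal.\<close>

definition delta_windows :: "nat \<Rightarrow> vseq" where
  "delta_windows j = (\<lambda>x k. if x = of_nat j \<and> k \<in> {1..2} then 1 else 0)"

lemma Lam_1_1: "Lam 1 1 = \<int>"
proof (intro equalityI subsetI)
  fix x assume "x \<in> Lam 1 1"
  then show "x \<in> \<int>" by (auto simp: Lam_def)
next
  fix x :: real assume "x \<in> \<int>"
  then obtain n where n: "x = of_int n" by (auto elim: Ints_cases)
  show "x \<in> Lam 1 1"
  proof (cases "even n")
    case True
    then obtain k where "n = 2 * k" by blast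
    with n have "x = 0 + 2 * of_int k" by simp
    then show ?thesis unfolding Lam_def by blast
  next
    case False
    then obtain k where "n = 2 * k + 1" by (blast elim: oddE)
    with n have "x = of_int 1 / of_nat 1 + 2 * of_int k" by simp
    then show ?thesis unfolding Lam_def by blast
  qed
qed

lemma delta_windows_in_ell2: "delta_windows j \<in> ell2 (Lam 1 1) 2"
proof -
  have "(\<lambda>x. \<Sum>k=1..2. (cmod (delta_windows j x k))\<^sup>2) summable_on \<int>"
    by (rule finite_nonzero_values_imp_summable_on, rule finite_subset[of _ "{of_nat j}"])
       (auto simp: delta_windows_def)
  then show ?thesis
    unfolding Lam_1_1 by (auto simp: ell2_def delta_windows_def)
qed

lemma gabor_elem_delta_windows:
  "gabor_elem 1 1 delta_windows (0, j, x) = (\<lambda>y k. if y = 2 * x + of_nat j \<and> k \<in> {1..2} then 1 else 0)"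
  by (auto simp: gabor_elem_def mod_op_def shift_op_def delta_windows_def fun_eq_iff)

text \<open>The series has at most one nonzero term. The set \<open>K\<close> covers both uses:
  \<open>{1}\<close> for a scalar row and \<open>{1..2}\<close> for the vector system.\<close>

lemma ell2_inner_delta:
  assumes "a \<in> L"
  shows "ell2_inner L S Z (\<lambda>y k. if y = a \<and> k \<in> K then 1 else 0) = (\<Sum>k\<in>{1..S} \<inter> K. Z a k)"
proof -
  have "((\<lambda>x. \<Sum>k=1..S. Z x k * cnj (if x = a \<and> k \<in> K then 1 else 0))
      has_sum (\<Sum>k\<in>{1..S} \<inter> K. Z a k)) L"
    by (rule has_sum_finite_neutralI[of "{a}"])
       (use assms in \<open>auto simp: sum.inter_restrict intro!: sum.cong\<close>)
  then show ?thesis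
    unfolding ell2_inner_def by (rule infsumI)
qed

text \<open>Division with remainder by 2: shifts by even integers of the point masses at 0 and 1
  reach every integer exactly once.\<close>

lemma bij_betw_two_cosets:
  "bij_betw (\<lambda>(m, j, x). 2 * x + of_nat (j - 1)) (gabor_index 1 1 1 {1..2}) (\<int> :: real set)"
proof (intro bij_betw_imageI inj_onI equalityI subsetI)
  fix i i' assume i: "i \<in> gabor_index 1 1 1 {1..2}" and i': "i' \<in> gabor_index 1 1 1 {1..2}"
    and eq: "(case i of (m, j, x) \<Rightarrow> 2 * x + real (j - 1)) = (case i' of (m, j, x) \<Rightarrow> 2 * x + real (j - 1))"
  from i obtain j k where j: "i = (0, j, of_int k)" "j \<in> {1..2}"
    unfolding gabor_index_def Lam_1_1 by (auto elim!: Ints_cases)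
  from i' obtain j' k' where j': "i' = (0, j', of_int k')" "j' \<in> {1..2}"
    unfolding gabor_index_def Lam_1_1 by (auto elim!: Ints_cases)
  have "real_of_int (2 * k + int (j - 1)) = real_of_int (2 * k' + int (j' - 1))"
    using eq j j' by simp
  then have "2 * k + int (j - 1) = 2 * k' + int (j' - 1)"
    by (simp only: of_int_eq_iff)
  \<comment> \<open>The remainders \<open>j - 1\<close> and \<open>j' - 1\<close> lie in
    \<open>{0, 1}\<close>, so parity separates them.\<close>
  with j(2) j'(2) have "k = k' \<and> j = j'" by (simp only: atLeastAtMost_iff) presburger
  with j j' show "i = i'" by simp
next
  fix y assume "y \<in> (\<lambda>(m, j, x). 2 * x + real (j - 1)) ` gabor_index 1 1 1 {1..2}"
  then show "y \<in> \<int>" unfolding gabor_index_def Lam_1_1 by auto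
next
  fix y :: real assume "y \<in> \<int>"
  then obtain n where n: "y = of_int n" by (auto elim: Ints_cases)
  \<comment> \<open>The quotient is the translation parameter; the remainder, raised by one, is the
    column number.\<close>
  define i where "i = (0 :: nat, Suc (nat (n mod 2)), real_of_int (n div 2))"
  have "i \<in> gabor_index 1 1 1 {1..2}"
    unfolding gabor_index_def Lam_1_1 i_def by (auto; presburger)
  moreover have "y = (case i of (m, j, x) \<Rightarrow> 2 * x + real (j - 1))"
  proof -
    have "real_of_int n = 2 * real_of_int (n div 2) + real_of_int (n mod 2)"
      by (metis mult_div_mod_eq of_int_add of_int_mult of_int_numeral)
    then show ?thesis
      by (simp add: i_def n)
  qed
  ultimately show "y \<in> (\<lambda>(m, j, x). 2 * x + real (j - 1)) ` gabor_index 1 1 1 {1..2}"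
    by (intro image_eqI)
qed

text \<open>The right-hand side is composed with the enumeration of
  \<open>bij_betw_two_cosets\<close>, ready for reindexing the coefficient series over the
  integers.\<close>

lemma gabor_coeff_delta_row:
  assumes "l \<in> {1..2}" "i \<in> gabor_index 1 1 1 {1..2}"
  shows "gabor_coeff 1 1 1 1 (window_matrix delta_windows l) z i
       = (\<lambda>y. (cmod (z y 1))\<^sup>2) (case i of (m, j, x) \<Rightarrow> 2 * x + of_nat (j - 1))"
proof -
  \<comment> \<open>\<open>M = 1\<close> leaves only \<open>m = 0\<close>, so there is no
    modulation.\<close>
  obtain j x where i: "i = (0, j, x)" "x \<in> \<int>"
    using assms(2) by (auto simp: gabor_index_def Lam_1_1)
  have "gabor_elem 1 1 (window_matrix delta_windows l) i
      = (\<lambda>y k. if y = 2 * x + of_nat (j - 1) \<and> k \<in> {1} then 1 else 0)"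
    using assms(1) i(1)
    by (auto simp: gabor_elem_def mod_op_def shift_op_def window_matrix_def delta_windows_def fun_eq_iff)
  moreover have "2 * x + of_nat (j - 1) \<in> Lam 1 1"
    unfolding Lam_1_1 using i(2) by simp
  ultimately show ?thesis
    by (simp only: gabor_coeff_def ell2_inner_delta i(1)) simp
qed

text \<open>Parseval's identity for the standard basis, hence both bounds equal 1.\<close>

lemma delta_windows_row_frame:
  assumes "l \<in> {1..2}"
  shows "dvnug_frame_bounds 1 1 1 1 {1..2} (window_matrix delta_windows l) 1 1"
proof -
  let ?c = "gabor_coeff 1 1 1 1 (window_matrix delta_windows l)" and ?I = "gabor_index 1 1 1 {1..2}"
  let ?h = "\<lambda>(m, j, x). 2 * x + of_nat (j - 1) :: real"
  have "?c z summable_on ?I" if z: "z \<in> ell2 (Lam 1 1) 1" for z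
  proof -
    have "?c z summable_on ?I \<longleftrightarrow> (\<lambda>i. (cmod (z (?h i) 1))\<^sup>2) summable_on ?I"
      by (intro summable_on_cong gabor_coeff_delta_row assms)
    also have "\<dots> \<longleftrightarrow> (\<lambda>y. (cmod (z y 1))\<^sup>2) summable_on \<int>"
      by (rule summable_on_reindex_bij_betw[OF bij_betw_two_cosets])
    finally show ?thesis
      using ell2_component_summable[OF z, of 1] by (simp add: Lam_1_1)
  qed
  moreover have "infsum (?c z) ?I = (ell2_norm (Lam 1 1) 1 z)\<^sup>2" for z
  proof -
    have "infsum (?c z) ?I = (\<Sum>\<^sub>\<infinity>i\<in>?I. (cmod (z (?h i) 1))\<^sup>2)"
      by (intro infsum_cong gabor_coeff_delta_row assms)
    also have "\<dots> = (\<Sum>\<^sub>\<infinity>y\<in>\<int>. (cmod (z y 1))\<^sup>2)"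
      by (rule infsum_reindex_bij_betw[OF bij_betw_two_cosets])
    finally show ?thesis
      by (simp add: ell2_norm_squared Lam_1_1)
  qed
  ultimately show ?thesis
    by (simp add: dvnug_frame_bounds_def)
qed

lemma delta_windows_not_frame: "\<not> dvnug_frame 1 1 1 2 {0..1} delta_windows"
proof
  assume "dvnug_frame 1 1 1 2 {0..1} delta_windows"
  then obtain A where "A > 0" and A: "\<And>Z. Z \<in> ell2 (Lam 1 1) 2 \<Longrightarrow> A * (ell2_norm (Lam 1 1) 2 Z)\<^sup>2
      \<le> infsum (gabor_coeff 1 1 1 2 delta_windows Z) (gabor_index 1 1 1 {0..1})"
    unfolding dvnug_frame_def dvnug_frame_bounds_def by blast
  \<comment> \<open>Opposite signs in the two coordinates cancel against windows with equal
    coordinates.\<close>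
  define Z :: vseq where "Z = (\<lambda>x k. if x = 0 then if k = 1 then 1 else if k = 2 then - 1 else 0 else 0)"
  have "((\<lambda>x. \<Sum>k=1..2. (cmod (Z x k))\<^sup>2) has_sum 2) (Lam 1 1)"
    unfolding Lam_1_1
    by (rule has_sum_finite_neutralI[of "{0}"]) (auto simp: Z_def numeral_2_eq_2 One_nat_def)
  then have "Z \<in> ell2 (Lam 1 1) 2" and norm: "(ell2_norm (Lam 1 1) 2 Z)\<^sup>2 = 2"
    unfolding ell2_norm_squared
    by (auto simp: ell2_def Z_def Lam_1_1 summable_on_def infsumI)
  have "gabor_coeff 1 1 1 2 delta_windows Z i = 0" if "i \<in> gabor_index 1 1 1 {0..1}" for i
  proof -
    obtain j x where i: "i = (0, j, x)" "x \<in> \<int>"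
      using \<open>i \<in> _\<close> by (auto simp: gabor_index_def Lam_1_1)
    have "2 * x + of_nat j \<in> Lam 1 1"
      unfolding Lam_1_1 using i(2) by simp
    \<comment> \<open>Each inner product is the sum of the two coordinates of \<open>Z\<close> at
      one point, which is 0 everywhere.\<close>
    then have "gabor_coeff 1 1 1 2 delta_windows Z i = (cmod (\<Sum>k=1..2. Z (2 * x + of_nat j) k))\<^sup>2"
      by (simp only: gabor_coeff_def i(1) gabor_elem_delta_windows ell2_inner_delta Int_absorb)
    then show ?thesis
      by (simp add: Z_def numeral_2_eq_2 One_nat_def)
  qed
  then have "infsum (gabor_coeff 1 1 1 2 delta_windows Z) (gabor_index 1 1 1 {0..1}) = 0"
    by (intro infsum_0)
  \<comment> \<open>The lower frame inequality would read \<open>A * 2 \<le> 0\<close>.\<close>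
  with A[OF \<open>Z \<in> _\<close>] norm \<open>A > 0\<close> show False by simp
qed

section \<open>Rows, failing converse and Bessel criterion together\<close>

theorem theorem5p2:
  fixes N M S P :: nat and r :: int and W :: "nat \<Rightarrow> vseq"
  assumes "N > 0" "M > 0" "S > 0"
    and "odd r" "coprime r (int N)" "1 \<le> r" "r \<le> 2 * int N - 1"
    and "\<forall>j\<in>{0..P}. W j \<in> ell2 (Lam N r) S"
  shows "(\<forall>A\<^sub>0 B\<^sub>0. dvnug_frame_bounds N r M S {0..P} W A\<^sub>0 B\<^sub>0 \<longrightarrow>
            (\<forall>l\<^sub>0\<in>{1..S}. dvnug_frame N r M 1 {1..P+1} (window_matrix W l\<^sub>0)))
       \<and> (\<exists>(N'::nat) (r'::int) (M'::nat) (P'::nat) (S'::nat) (W'::nat \<Rightarrow> vseq).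
            N' > 0 \<and> M' > 0 \<and> S' > 0 \<and>
            odd r' \<and> coprime r' (int N') \<and> 1 \<le> r' \<and> r' \<le> 2 * int N' - 1 \<and>
            (\<forall>j\<in>{0..P'}. W' j \<in> ell2 (Lam N' r') S') \<and>
            (\<forall>l\<^sub>0\<in>{1..S'}. dvnug_frame N' r' M' 1 {1..P'+1} (window_matrix W' l\<^sub>0)) \<and>
            \<not> dvnug_frame N' r' M' S' {0..P'} W')
       \<and> (dvnug_bessel N r M S {0..P} W \<longleftrightarrow>
            (\<forall>l\<in>{1..S}. \<forall>l'\<in>{1..P+1}. dvnug_bessel N r M 1 {l'} (window_matrix W l)))"
proof (intro conjI)
  show "\<forall>A\<^sub>0 B\<^sub>0. dvnug_frame_bounds N r M S {0..P} W A\<^sub>0 B\<^sub>0 \<longrightarrow>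
      (\<forall>l\<^sub>0\<in>{1..S}. dvnug_frame N r M 1 {1..P+1} (window_matrix W l\<^sub>0))"
    using frame_bounds_row unfolding dvnug_frame_def by blast
  show "dvnug_bessel N r M S {0..P} W \<longleftrightarrow>
      (\<forall>l\<in>{1..S}. \<forall>l'\<in>{1..P+1}. dvnug_bessel N r M 1 {l'} (window_matrix W l))"
    using assms by (intro bessel_iff_entries)
  show "\<exists>(N'::nat) (r'::int) (M'::nat) (P'::nat) (S'::nat) (W'::nat \<Rightarrow> vseq).
      N' > 0 \<and> M' > 0 \<and> S' > 0 \<and>
      odd r' \<and> coprime r' (int N') \<and> 1 \<le> r' \<and> r' \<le> 2 * int N' - 1 \<and>
      (\<forall>j\<in>{0..P'}. W' j \<in> ell2 (Lam N' r') S') \<and>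
      (\<forall>l\<^sub>0\<in>{1..S'}. dvnug_frame N' r' M' 1 {1..P'+1} (window_matrix W' l\<^sub>0)) \<and>
      \<not> dvnug_frame N' r' M' S' {0..P'} W'"
  \<comment> \<open>The witnesses are \<open>N' = r' = M' = P' = 1\<close> and
    \<open>S' = 2\<close>; \<open>P' = 1\<close> means the two windows numbered 0 and 1.\<close>
  proof (rule exI[of _ 1], rule exI[of _ 1], rule exI[of _ 1], rule exI[of _ 1], rule exI[of _ 2],
      rule exI[of _ delta_windows], intro conjI)
    show "\<forall>l\<^sub>0\<in>{1..2}. dvnug_frame 1 1 1 1 {1..1+1} (window_matrix delta_windows l\<^sub>0)"
      using delta_windows_row_frame unfolding dvnug_frame_def one_add_one by blast
    show "\<forall>j\<in>{0..1}. delta_windows j \<in> ell2 (Lam 1 1) 2"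
      using delta_windows_in_ell2 by blast
  qed (simp_all add: delta_windows_not_frame)
qed

end
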